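(* Let $R_0$ be a commutative associative ring (not necessarily unital), $G$ a group and $\alpha=(\{R_t\}_{t\in G},\{\alpha_t\}_{t\in G})$ a partial action of $G$ on $R_0$ such that, for each $t\in G$, the ideal $R_t$ contains a set of local units. Then $R_0\delta_0$ is maximal commutative in the partial skew group ring $R_0\rtimes_\alpha G$ if and only if $I\cap R_0\delta_0\neq\{0\}$ for each non-zero (two-sided) ideal $I$ of $R_0\rtimes_\alpha G$.
   Context: The group $G$ is arbitrary and written multiplicatively, but its identity element is denoted by $0$. A partial action of $G$ on a ring $R_0$ is a pair $\alpha=(\{R_t\}_{t\in G},\{\alpha_t\}_{t\in G})$, where for each $t\in G$, $R_t$ is a (two-sided) ideal of $R_0$ and $\alpha_t:R_{t^{-1}}\to R_t$ is a ring isomorphism, such that: the ideal attached to the identity element of $G$ is $R_0$ (the whole ring) and the corresponding map is the identity map of $R_0$; $\alpha_t(R_{t^{-1}}\cap R_s)=R_t\cap R_{ts}$ for all $s,t\in G$; and $\alpha_t(\alpha_s(x))=\alpha_{ts}(x)$ for all $s,t\in G$ and $x\in R_{s^{-1}}\cap R_{s^{-1}t^{-1}}$. A ring $S$ contains a set of local units if there is a set $E\subseteq S$ of idempotents such that for every $x\in S$ there is $e\in E$ with $ex=xe=x$. The partial skew group ring $R_0\rtimes_\alpha G$ is the set of all finite formal sums $\sum_{t\in G}a_t\delta_t$ with $a_t\in R_t$ and $\delta_t$ a symbol, with componentwise addition and multiplication determined by $(a_t\delta_t)(b_s\delta_s)=\alpha_t(\alpha_{t^{-1}}(a_t)b_s)\delta_{ts}$.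 (Under the local units hypothesis it is known to be associative.) $R_0\delta_0=\{a\delta_0:a\in R_0\}$, where $\delta_0$ is the symbol of the identity element of $G$. A nonempty subset $S$ of a ring $R$ is maximal commutative in $R$ if $C_R(S)=S$, where $C_R(S)$ is the set of all elements of $R$ that commute with every element of $S$. *)

theory Defs
  imports Main "HOL-Library.Poly_Mapping"
begin

text \<open>
  The group is a type of class \<open>group_add\<close>, which is not assumed abelian: the product \<open>ts\<close> is
  \<open>t + s\<close>, the inverse of \<open>t\<close> is \<open>- t\<close>, and the identity element is \<open>0\<close>. The ring \<open>R\<^sub>0\<close> is a type
  of class \<open>ring\<close> or \<open>comm_ring\<close>, which need not have a unit (and may be the zero ring).

  The next three notions concern a ring given by a subset of an additive group and a
  multiplication \<open>m\<close>, so that they apply both to \<open>R\<^sub>0\<close> and to the partial skew group ring.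
\<close>

definition two_sided_ideal :: "('r \<Rightarrow> 'r \<Rightarrow> 'r) \<Rightarrow> 'r::ab_group_add set \<Rightarrow> 'r set \<Rightarrow> bool" where
  "two_sided_ideal m A I \<longleftrightarrow>
     I \<subseteq> A \<and> 0 \<in> I \<and> (\<forall>x\<in>I. \<forall>y\<in>I. x - y \<in> I) \<and>
     (\<forall>a\<in>A. \<forall>x\<in>I. m a x \<in> I \<and> m x a \<in> I)"

definition centralizer_in :: "('r \<Rightarrow> 'r \<Rightarrow> 'r) \<Rightarrow> 'r set \<Rightarrow> 'r set \<Rightarrow> 'r set" where
  "centralizer_in m A S = {a \<in> A. \<forall>s\<in>S. m a s = m s a}"

definition maximal_commutative_in :: "('r \<Rightarrow> 'r \<Rightarrow> 'r) \<Rightarrow> 'r set \<Rightarrow> 'r set \<Rightarrow> bool" where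
  "maximal_commutative_in m A S \<longleftrightarrow> S \<noteq> {} \<and> S \<subseteq> A \<and> centralizer_in m A S = S"

definition has_local_units :: "'a::ring set \<Rightarrow> bool" where
  "has_local_units S \<longleftrightarrow>
     (\<exists>E\<subseteq>S. (\<forall>e\<in>E. e * e = e) \<and> (\<forall>x\<in>S. \<exists>e\<in>E. e * x = x \<and> x * e = x))"

text \<open>
  Only the restriction of \<open>\<alpha> t\<close> to \<open>R (- t)\<close> is meaningful; its values elsewhere are arbitrary.
\<close>

locale partial_action =
  fixes R :: "'g::group_add \<Rightarrow> 'a::ring set"
    and \<alpha> :: "'g \<Rightarrow> 'a \<Rightarrow> 'a"
  assumes ideal: "two_sided_ideal (*) UNIV (R t)"
    and bij: "bij_betw (\<alpha> t) (R (- t)) (R t)"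
    and add: "x \<in> R (- t) \<Longrightarrow> y \<in> R (- t) \<Longrightarrow> \<alpha> t (x + y) = \<alpha> t x + \<alpha> t y"
    and mult: "x \<in> R (- t) \<Longrightarrow> y \<in> R (- t) \<Longrightarrow> \<alpha> t (x * y) = \<alpha> t x * \<alpha> t y"
    and domain_identity: "R 0 = UNIV"
    and map_identity: "\<alpha> 0 x = x"
    and image_Int: "\<alpha> t ` (R (- t) \<inter> R s) = R t \<inter> R (t + s)"
    and compose: "x \<in> R (- s) \<inter> R (- s + - t) \<Longrightarrow> \<alpha> t (\<alpha> s x) = \<alpha> (t + s) x"

text \<open>
  A formal sum \<open>\<Sum> a\<^sub>t \<delta>\<^sub>t\<close> is the finitely supported function \<open>t \<mapsto> a\<^sub>t\<close>, and \<open>a \<delta>\<^sub>t\<close> is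
  \<open>Poly_Mapping.single t a\<close>. Addition is the componentwise one of \<open>poly_mapping\<close>; multiplication is
  \<open>skew_mult\<close> below, not the (untwisted) convolution product \<open>(*)\<close> of \<open>poly_mapping\<close>.
\<close>

definition skew_ring :: "('g \<Rightarrow> 'a::ring set) \<Rightarrow> ('g \<Rightarrow>\<^sub>0 'a) set" where
  "skew_ring R = {f. \<forall>t. Poly_Mapping.lookup f t \<in> R t}"

definition skew_mult ::
    "('g::group_add \<Rightarrow> 'a::ring \<Rightarrow> 'a) \<Rightarrow> ('g \<Rightarrow>\<^sub>0 'a) \<Rightarrow> ('g \<Rightarrow>\<^sub>0 'a) \<Rightarrow> ('g \<Rightarrow>\<^sub>0 'a)" where
  "skew_mult \<alpha> f g =
     (\<Sum>t\<in>Poly_Mapping.keys f. \<Sum>s\<in>Poly_Mapping.keys g.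
        Poly_Mapping.single (t + s)
          (\<alpha> t (\<alpha> (- t) (Poly_Mapping.lookup f t) * Poly_Mapping.lookup g s)))"

definition base_ring :: "('g::group_add \<Rightarrow> 'a::ring set) \<Rightarrow> ('g \<Rightarrow>\<^sub>0 'a) set" where
  "base_ring R = {Poly_Mapping.single 0 a | a. a \<in> R 0}"

context partial_action
begin

lemma zero_mem: "0 \<in> R t"
  using ideal[of t] by (simp add: two_sided_ideal_def)

lemma map_zero: "\<alpha> t 0 = 0"
  using add[of 0 t 0] zero_mem[of "- t"] by simp

lemma skew_mult_single:
  "skew_mult \<alpha> (Poly_Mapping.single t a) (Poly_Mapping.single s b) =
     Poly_Mapping.single (t + s) (\<alpha> t (\<alpha> (- t) a * b))"
  by (cases "a = 0"; cases "b = 0") (simp_all add: skew_mult_def map_zero)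

lemma map_product_mem:
  assumes "a \<in> R t" and "b \<in> R s"
  shows "\<alpha> t (\<alpha> (- t) a * b) \<in> R (t + s)"
proof -
  have "\<alpha> (- t) a \<in> R (- t)"
    using bij_betwE[OF bij[of "- t"]] assms by simp
  then have "\<alpha> (- t) a * b \<in> R (- t) \<inter> R s"
    using ideal[of "- t"] ideal[of s] assms by (simp add: two_sided_ideal_def)
  then show ?thesis
    using image_Int[of t s] by blast
qed

lemma sum_mem:
  assumes "\<And>i. i \<in> A \<Longrightarrow> h i \<in> R t"
  shows "sum h A \<in> R t"
proof -
  have add_mem: "x + y \<in> R t" if "x \<in> R t" "y \<in> R t" for x y
  proof -
    have "0 - y \<in> R t" using ideal[of t] that zero_mem[of t] unfolding two_sided_ideal_def by blast
    then have "x - (0 - y) \<in> R t" using ideal[of t] that unfolding two_sided_ideal_def by blast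
    then show ?thesis by simp
  qed
  show ?thesis
    using assms by (induction A rule: infinite_finite_induct) (auto simp: zero_mem add_mem)
qed

lemma skew_mult_mem:
  assumes "f \<in> skew_ring R" and "g \<in> skew_ring R"
  shows "skew_mult \<alpha> f g \<in> skew_ring R"
proof -
  have "Poly_Mapping.lookup (skew_mult \<alpha> f g) u \<in> R u" for u
    unfolding skew_mult_def lookup_sum
    using assms
    by (intro sum_mem)
      (auto simp: lookup_single when_def zero_mem skew_ring_def intro: map_product_mem)
  then show ?thesis
    by (simp add: skew_ring_def)
qed

end

end

theory Submission
  imports Defs
begin

text \<open>
  Suppose first that \<open>R\<^sub>0 \<delta>\<^sub>0\<close> is maximal commutative, and let \<open>f\<close> be a non-zero element of an
  ideal whose support is as small as possible. Multiplying \<open>f\<close> on the right by \<open>e \<delta>\<^bsub>-t\<^esub>\<close>, with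
  \<open>t\<close> in the support and \<open>e\<close> a suitable local unit, moves the coefficient at \<open>t\<close> to the identity
  of the group without enlarging the support. The commutator of the new element with any \<open>a \<delta>\<^sub>0\<close>
  has coefficient \<open>0\<close> at the identity because \<open>R\<^sub>0\<close> is commutative, so it has smaller support and
  vanishes. Hence the new element centralizes \<open>R\<^sub>0 \<delta>\<^sub>0\<close>, and so lies in it
  (\<open>ideal_meets_centralizer\<close>).

  For the converse, let the partial skew group ring act on the additive group of \<open>R\<^sub>0\<close>, with
  \<open>a \<delta>\<^sub>t\<close> acting by \<open>x \<mapsto> \<alpha>\<^sub>t (\<alpha>\<^bsub>-t\<^esub>(a) x)\<close>. Local units make this a representation
  (\<open>action_skew_mult\<close>), so its kernel is an ideal. An element \<open>a \<delta>\<^sub>0\<close> acts by multiplication by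
  \<open>a\<close>, hence faithfully, and the kernel meets \<open>R\<^sub>0 \<delta>\<^sub>0\<close> only in \<open>0\<close>. If \<open>f\<close> centralizes
  \<open>R\<^sub>0 \<delta>\<^sub>0\<close> and \<open>a\<close> is its coefficient at \<open>t\<close>, then comparing coefficients at \<open>t\<close> shows that
  \<open>a \<delta>\<^sub>t\<close>, too, acts by multiplication by \<open>a\<close>. So \<open>a \<delta>\<^sub>0 - a \<delta>\<^sub>t\<close> lies in the kernel. When every
  non-zero ideal meets \<open>R\<^sub>0 \<delta>\<^sub>0\<close> non-trivially, the kernel is zero, which forces \<open>a = 0\<close> for
  every \<open>t \<noteq> 0\<close>.
\<close>

locale partial_action_with_local_units = partial_action R \<alpha>
  for R :: "'g::group_add \<Rightarrow> 'a::ring set" and \<alpha> :: "'g \<Rightarrow> 'a \<Rightarrow> 'a" +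
  assumes local_units: "has_local_units (R t)"
begin

section \<open>Ideals and isomorphisms of the partial action\<close>

lemma diff_mem: "x \<in> R t \<Longrightarrow> y \<in> R t \<Longrightarrow> x - y \<in> R t"
  using ideal[of t] by (simp add: two_sided_ideal_def)

lemma mult_left_mem: "x \<in> R t \<Longrightarrow> a * x \<in> R t"
  using ideal[of t] by (simp add: two_sided_ideal_def)

lemma mult_right_mem: "x \<in> R t \<Longrightarrow> x * a \<in> R t"
  using ideal[of t] by (simp add: two_sided_ideal_def)

lemma map_mem: "x \<in> R (- t) \<Longrightarrow> \<alpha> t x \<in> R t"
  using bij_betwE[OF bij[of t]] by blast

lemma map_minus_mem: "x \<in> R t \<Longrightarrow> \<alpha> (- t) x \<in> R (- t)"
  using map_mem[of x "- t"] by simp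

lemma map_map_minus: "x \<in> R t \<Longrightarrow> \<alpha> t (\<alpha> (- t) x) = x"
  using compose[of x "- t" t] by (simp add: domain_identity map_identity)

lemma local_unitE:
  assumes "x \<in> R t"
  obtains e where "e \<in> R t" "e * x = x" "x * e = x"
  using local_units[of t] assms unfolding has_local_units_def by blast

section \<open>The partial skew group ring\<close>

lemma zero_in_skew_ring: "0 \<in> skew_ring R"
  by (simp add: skew_ring_def zero_mem)

lemma single_in_skew_ring: "a \<in> R t \<Longrightarrow> Poly_Mapping.single t a \<in> skew_ring R"
  by (auto simp: skew_ring_def lookup_single when_def zero_mem)

lemma diff_in_skew_ring: "f \<in> skew_ring R \<Longrightarrow> g \<in> skew_ring R \<Longrightarrow> f - g \<in> skew_ring R"
  by (simp add: skew_ring_def lookup_minus diff_mem)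

lemma sum_in_skew_ring: "(\<And>i. i \<in> A \<Longrightarrow> h i \<in> skew_ring R) \<Longrightarrow> sum h A \<in> skew_ring R"
  by (auto simp: skew_ring_def lookup_sum intro: sum_mem)

lemma base_ring_eq: "base_ring R = range (Poly_Mapping.single 0)"
  by (auto simp: base_ring_def domain_identity)

lemma base_ring_subset: "base_ring R \<subseteq> skew_ring R"
  by (auto simp: base_ring_eq domain_identity intro: single_in_skew_ring)

lemma lookup_skew_mult_single_right:
  "Poly_Mapping.lookup (skew_mult \<alpha> f (Poly_Mapping.single s b)) u =
     \<alpha> (u - s) (\<alpha> (- (u - s)) (Poly_Mapping.lookup f (u - s)) * b)"
proof -
  have "skew_mult \<alpha> f (Poly_Mapping.single s b) =
      (\<Sum>t\<in>Poly_Mapping.keys f.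
         Poly_Mapping.single (t + s) (\<alpha> t (\<alpha> (- t) (Poly_Mapping.lookup f t) * b)))"
    by (cases "b = 0") (simp_all add: skew_mult_def map_zero)
  moreover have "(t + s = u) = (t = u - s)" for t
    by (auto simp: algebra_simps)
  ultimately show ?thesis
    by (simp add: lookup_sum lookup_single when_def in_keys_iff map_zero)
qed

lemma lookup_skew_mult_single_zero_left:
  "Poly_Mapping.lookup (skew_mult \<alpha> (Poly_Mapping.single 0 b) f) u = b * Poly_Mapping.lookup f u"
proof -
  have "skew_mult \<alpha> (Poly_Mapping.single 0 b) f =
      (\<Sum>s\<in>Poly_Mapping.keys f. Poly_Mapping.single s (b * Poly_Mapping.lookup f s))"
    by (cases "b = 0") (simp_all add: skew_mult_def map_identity)
  then show ?thesis
    by (simp add: lookup_sum lookup_single when_def in_keys_iff)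
qed

lemma card_keys_skew_mult_single_right_le:
  "card (Poly_Mapping.keys (skew_mult \<alpha> f (Poly_Mapping.single s b))) \<le> card (Poly_Mapping.keys f)"
proof -
  have "Poly_Mapping.keys (skew_mult \<alpha> f (Poly_Mapping.single s b))
      \<subseteq> (\<lambda>t. t + s) ` Poly_Mapping.keys f"
  proof
    fix u assume "u \<in> Poly_Mapping.keys (skew_mult \<alpha> f (Poly_Mapping.single s b))"
    then have "u - s \<in> Poly_Mapping.keys f"
      by (auto simp: in_keys_iff lookup_skew_mult_single_right map_zero)
    then have "(u - s) + s \<in> (\<lambda>t. t + s) ` Poly_Mapping.keys f"
      by (rule imageI)
    then show "u \<in> (\<lambda>t. t + s) ` Poly_Mapping.keys f"
      by simp
  qed
  then show ?thesis
    by (meson card_image_le card_mono finite_imageI finite_keys le_trans)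
qed

section \<open>Every non-zero ideal meets the centralizer of the base ring\<close>

text \<open>
  An element of smallest support in the ideal, shifted so that its coefficient at the identity is
  non-zero, must commute with the base ring: its commutators with \<open>a \<delta>\<^sub>0\<close> lie in the ideal and
  have lost that coefficient.
\<close>

lemma ideal_meets_centralizer:
  assumes comm: "\<And>x y :: 'a. x * y = y * x"
    and I: "two_sided_ideal (skew_mult \<alpha>) (skew_ring R) I" and "I \<noteq> {0}"
  obtains g where "g \<in> I" "g \<noteq> 0"
    "g \<in> centralizer_in (skew_mult \<alpha>) (skew_ring R) (base_ring R)"
proof -
  have I_subset: "I \<subseteq> skew_ring R" and "0 \<in> I"
    and I_diff: "\<And>x y. x \<in> I \<Longrightarrow> y \<in> I \<Longrightarrow> x - y \<in> I"
    and I_left: "\<And>a x. a \<in> skew_ring R \<Longrightarrow> x \<in> I \<Longrightarrow> skew_mult \<alpha> a x \<in> I"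
    and I_right: "\<And>a x. a \<in> skew_ring R \<Longrightarrow> x \<in> I \<Longrightarrow> skew_mult \<alpha> x a \<in> I"
    using I by (auto simp: two_sided_ideal_def)
  obtain f0 where "f0 \<in> I \<and> f0 \<noteq> 0"
    using \<open>0 \<in> I\<close> \<open>I \<noteq> {0}\<close> by blast
  then obtain f where f: "f \<in> I" "f \<noteq> 0"
    and least: "\<And>g. g \<in> I \<Longrightarrow> g \<noteq> 0 \<Longrightarrow>
      card (Poly_Mapping.keys f) \<le> card (Poly_Mapping.keys g)"
    using ex_has_least_nat[of "\<lambda>f. f \<in> I \<and> f \<noteq> 0" f0 "\<lambda>f. card (Poly_Mapping.keys f)"]
    by blast
  obtain t where t: "Poly_Mapping.lookup f t \<noteq> 0"
    using \<open>f \<noteq> 0\<close> by (metis poly_mapping_eqI lookup_zero)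
  have ft: "Poly_Mapping.lookup f t \<in> R t"
    using f I_subset by (auto simp: skew_ring_def)
  obtain e where e: "e \<in> R (- t)"
    and unit: "\<alpha> (- t) (Poly_Mapping.lookup f t) * e = \<alpha> (- t) (Poly_Mapping.lookup f t)"
    using local_unitE[OF map_minus_mem[OF ft]] by metis
  define g where "g = skew_mult \<alpha> f (Poly_Mapping.single (- t) e)"
  have "g \<in> I"
    unfolding g_def using e f by (intro I_right single_in_skew_ring)
  have g0: "Poly_Mapping.lookup g 0 \<noteq> 0"
    using t by (simp add: g_def lookup_skew_mult_single_right unit map_map_minus[OF ft])
  have card_g: "card (Poly_Mapping.keys g) \<le> card (Poly_Mapping.keys f)"
    unfolding g_def by (rule card_keys_skew_mult_single_right_le)
  have "skew_mult \<alpha> g (Poly_Mapping.single 0 a) = skew_mult \<alpha> (Poly_Mapping.single 0 a) g" for a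
  proof -
    define h where
      "h = skew_mult \<alpha> g (Poly_Mapping.single 0 a) - skew_mult \<alpha> (Poly_Mapping.single 0 a) g"
    have "Poly_Mapping.single 0 a \<in> skew_ring R"
      by (simp add: single_in_skew_ring domain_identity)
    with \<open>g \<in> I\<close> have "h \<in> I"
      unfolding h_def by (intro I_diff I_left I_right)
    have lookup_h: "Poly_Mapping.lookup h u =
        \<alpha> u (\<alpha> (- u) (Poly_Mapping.lookup g u) * a) - a * Poly_Mapping.lookup g u" for u
      by (simp add: h_def lookup_minus lookup_skew_mult_single_right
          lookup_skew_mult_single_zero_left)
    have "Poly_Mapping.keys h \<subseteq> Poly_Mapping.keys g - {0}"
      using comm by (auto simp: in_keys_iff lookup_h map_zero map_identity)
    then have "card (Poly_Mapping.keys h) < card (Poly_Mapping.keys g)"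
      using g0 by (intro psubset_card_mono) (auto simp: in_keys_iff)
    with card_g have "h = 0"
      using least[OF \<open>h \<in> I\<close>] by fastforce
    then show ?thesis
      by (simp add: h_def)
  qed
  then have "g \<in> centralizer_in (skew_mult \<alpha>) (skew_ring R) (base_ring R)"
    using \<open>g \<in> I\<close> I_subset by (auto simp: centralizer_in_def base_ring_eq)
  moreover have "g \<noteq> 0"
    using g0 by auto
  ultimately show ?thesis
    using \<open>g \<in> I\<close> that by blast
qed

section \<open>The representation on the base ring\<close>

text \<open>
  This is the coefficient of \<open>(a \<delta>\<^sub>t) (x \<delta>\<^sub>0)\<close>: the action is left multiplication of
  the partial skew group ring on itself, read on \<open>R\<^sub>0\<close> after forgetting the group component.
\<close>

definition monomial_action :: "'g \<Rightarrow> 'a \<Rightarrow> 'a \<Rightarrow> 'a" where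
  "monomial_action t a x = \<alpha> t (\<alpha> (- t) a * x)"

definition action :: "('g \<Rightarrow>\<^sub>0 'a) \<Rightarrow> 'a \<Rightarrow> 'a" where
  "action f x = (\<Sum>t\<in>Poly_Mapping.keys f. monomial_action t (Poly_Mapping.lookup f t) x)"

definition action_kernel :: "('g \<Rightarrow>\<^sub>0 'a) set" where
  "action_kernel = {f \<in> skew_ring R. \<forall>x. action f x = 0}"

lemma monomial_action_zero_left: "monomial_action t 0 x = 0"
  by (simp add: monomial_action_def map_zero)

lemma monomial_action_zero_right: "monomial_action t a 0 = 0"
  by (simp add: monomial_action_def map_zero)

lemma monomial_action_identity: "monomial_action 0 a x = a * x"
  by (simp add: monomial_action_def map_identity)

lemma monomial_action_add_left:
  assumes "a \<in> R t" "b \<in> R t"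
  shows "monomial_action t (a + b) x = monomial_action t a x + monomial_action t b x"
  using assms add[of a "- t" b] add[of "\<alpha> (- t) a * x" t "\<alpha> (- t) b * x"]
  by (simp add: monomial_action_def distrib_right map_minus_mem mult_right_mem)

lemma monomial_action_add_right:
  assumes "a \<in> R t"
  shows "monomial_action t a (x + y) = monomial_action t a x + monomial_action t a y"
  using assms add[of "\<alpha> (- t) a * x" t "\<alpha> (- t) a * y"]
  by (simp add: monomial_action_def distrib_left map_minus_mem mult_right_mem)

lemma monomial_action_sum_right:
  assumes "a \<in> R t"
  shows "monomial_action t a (sum h A) = (\<Sum>i\<in>A. monomial_action t a (h i))"
  using assms
  by (induction A rule: infinite_finite_induct)
    (simp_all add: monomial_action_zero_right monomial_action_add_right)

text \<open>
  Conjugation by \<open>\<alpha>\<^sub>s\<close> turns left multiplication by \<open>\<alpha>\<^bsub>-s\<^esub>(c)\<close> on \<open>R\<^bsub>-s\<^esub>\<close> into left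
  multiplication by \<open>c\<close> on \<open>R\<^sub>s\<close>.
\<close>

lemma monomial_action_mult:
  assumes "c \<in> R s" "b \<in> R s"
  shows "monomial_action s (c * b) x = c * monomial_action s b x"
proof -
  have "\<alpha> (- s) (c * b) = \<alpha> (- s) c * \<alpha> (- s) b"
    using assms by (intro mult) simp_all
  then have "monomial_action s (c * b) x = \<alpha> s (\<alpha> (- s) c * (\<alpha> (- s) b * x))"
    by (simp add: monomial_action_def mult.assoc)
  also have "\<dots> = \<alpha> s (\<alpha> (- s) c) * \<alpha> s (\<alpha> (- s) b * x)"
    using assms by (intro mult mult_right_mem map_minus_mem)
  finally show ?thesis
    using assms by (simp add: monomial_action_def map_map_minus)
qed

text \<open>
  The element \<open>c\<close> may lie outside \<open>R\<^sub>s\<close>, where \<open>\<alpha>\<^bsub>-s\<^esub>\<close> has no multiplicative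
  meaning. If \<open>e\<close> is a local unit of \<open>b\<close>, then \<open>c * e\<close> lies in \<open>R\<^sub>s\<close> and can stand in for
  \<open>c\<close>.
\<close>

lemma monomial_action_mult':
  assumes "b \<in> R s"
  shows "monomial_action s (c * b) x = c * monomial_action s b x"
proof -
  obtain e where e: "e \<in> R s" "e * b = b"
    using local_unitE[OF assms] by metis
  have "monomial_action s (c * b) x = monomial_action s ((c * e) * b) x"
    using e by (simp add: mult.assoc)
  also have "\<dots> = (c * e) * monomial_action s b x"
    using e assms by (intro monomial_action_mult mult_left_mem)
  also have "\<dots> = c * (e * monomial_action s b x)"
    by (rule mult.assoc)
  also have "e * monomial_action s b x = monomial_action s b x"
    using e assms monomial_action_mult[of e s b x] by simp
  finally show ?thesis .
qed

text \<open>
  Since \<open>\<alpha>\<^bsub>-t\<^esub>(a) b\<close> lies in both \<open>R\<^bsub>-t\<^esub>\<close> and \<open>R\<^sub>s\<close>, the map attached to \<open>t + s\<close> factors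
  through those of \<open>s\<close> and \<open>t\<close> on everything that occurs. What remains is to pull the factor
  \<open>\<alpha>\<^bsub>-t\<^esub>(a)\<close> out of the inner action.
\<close>

lemma monomial_action_skew_mult:
  assumes a: "a \<in> R t" and b: "b \<in> R s"
  shows "monomial_action (t + s) (\<alpha> t (\<alpha> (- t) a * b)) x =
    monomial_action t a (monomial_action s b x)"
proof -
  define y where "y = \<alpha> (- t) a * b"
  have y: "y \<in> R (- t)" "y \<in> R s"
    unfolding y_def using a b by (simp_all add: map_minus_mem mult_right_mem mult_left_mem)
  \<comment> \<open>The cocycle identity applies because \<open>y\<close> and \<open>\<alpha> (- s) y * x\<close> lie in the intersections of
     domains that it asks for.\<close>
  have "- s + - t + t = - s"
    by (simp add: add.assoc)
  then have 1: "\<alpha> (- (t + s)) (\<alpha> t y) = \<alpha> (- s) y"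
    using compose[of y t "- (t + s)"] y by (simp add: minus_add)
  have "\<alpha> (- s) y \<in> R (- s) \<inter> R (- s + - t)"
    using image_Int[of "- s" "- t"] y by auto
  then have "\<alpha> (- s) y * x \<in> R (- s) \<inter> R (- s + - t)"
    by (simp add: mult_right_mem)
  then have 2: "\<alpha> (t + s) (\<alpha> (- s) y * x) = \<alpha> t (\<alpha> s (\<alpha> (- s) y * x))"
    by (rule compose[symmetric])
  have "monomial_action (t + s) (\<alpha> t y) x = \<alpha> t (monomial_action s y x)"
    by (simp only: monomial_action_def 1 2)
  also have "monomial_action s y x = \<alpha> (- t) a * monomial_action s b x"
    unfolding y_def by (rule monomial_action_mult'[OF b])
  finally show ?thesis
    by (simp add: y_def monomial_action_def)
qed

lemma action_eq_sum:
  assumes "finite A" "Poly_Mapping.keys f \<subseteq> A"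
  shows "action f x = (\<Sum>t\<in>A. monomial_action t (Poly_Mapping.lookup f t) x)"
  unfolding action_def using assms
  by (intro sum.mono_neutral_left) (auto simp: in_keys_iff monomial_action_zero_left)

lemma action_single: "action (Poly_Mapping.single t a) x = monomial_action t a x"
  by (simp add: action_eq_sum[of "{t}"])

lemma action_zero_left: "action 0 x = 0"
  by (simp add: action_def)

lemma action_zero_right: "action f 0 = 0"
  by (simp add: action_def monomial_action_zero_right)

lemma action_add:
  assumes "f \<in> skew_ring R" "g \<in> skew_ring R"
  shows "action (f + g) x = action f x + action g x"
proof -
  let ?A = "Poly_Mapping.keys f \<union> Poly_Mapping.keys g"
  have "action (f + g) x = (\<Sum>t\<in>?A. monomial_action t (Poly_Mapping.lookup (f + g) t) x)"
    by (rule action_eq_sum) (simp_all add: keys_add)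
  also have "\<dots> = (\<Sum>t\<in>?A. monomial_action t (Poly_Mapping.lookup f t) x
      + monomial_action t (Poly_Mapping.lookup g t) x)"
    using assms by (simp add: lookup_add skew_ring_def monomial_action_add_left)
  finally show ?thesis
    by (simp add: sum.distrib action_eq_sum[of ?A])
qed

lemma action_diff:
  assumes "f \<in> skew_ring R" "g \<in> skew_ring R"
  shows "action (f - g) x = action f x - action g x"
  using action_add[OF diff_in_skew_ring[OF assms] assms(2), of x] by simp

lemma action_sum:
  assumes "finite A" "\<And>i. i \<in> A \<Longrightarrow> h i \<in> skew_ring R"
  shows "action (sum h A) x = (\<Sum>i\<in>A. action (h i) x)"
  using assms
  by (induction A) (simp_all add: action_zero_left action_add sum_in_skew_ring)

lemma action_skew_mult:
  assumes "f \<in> skew_ring R" "g \<in> skew_ring R"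
  shows "action (skew_mult \<alpha> f g) x = action f (action g x)"
proof -
  let ?f = "Poly_Mapping.lookup f" and ?g = "Poly_Mapping.lookup g"
  let ?summand = "\<lambda>t s. Poly_Mapping.single (t + s) (\<alpha> t (\<alpha> (- t) (?f t) * ?g s))"
  have f: "?f t \<in> R t" and g: "?g t \<in> R t" for t
    using assms by (simp_all add: skew_ring_def)
  have summand: "?summand t s \<in> skew_ring R" for t s
    by (intro single_in_skew_ring map_product_mem f g)
  have "action (skew_mult \<alpha> f g) x =
      (\<Sum>t\<in>Poly_Mapping.keys f. \<Sum>s\<in>Poly_Mapping.keys g. action (?summand t s) x)"
    by (simp add: skew_mult_def action_sum sum_in_skew_ring summand)
  also have "\<dots> = (\<Sum>t\<in>Poly_Mapping.keys f. \<Sum>s\<in>Poly_Mapping.keys g.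
      monomial_action t (?f t) (monomial_action s (?g s) x))"
    by (simp add: action_single monomial_action_skew_mult f g)
  also have "\<dots> = (\<Sum>t\<in>Poly_Mapping.keys f. monomial_action t (?f t) (action g x))"
    by (simp add: action_def monomial_action_sum_right f)
  finally show ?thesis
    by (simp add: action_def)
qed

lemma action_kernel_ideal: "two_sided_ideal (skew_mult \<alpha>) (skew_ring R) action_kernel"
  unfolding two_sided_ideal_def action_kernel_def
  by (auto simp: zero_in_skew_ring action_zero_left action_zero_right diff_in_skew_ring
      action_diff skew_mult_mem action_skew_mult)

lemma action_kernel_Int_base_ring: "action_kernel \<inter> base_ring R = {0}"
proof -
  have "a = 0" if "Poly_Mapping.single 0 a \<in> action_kernel" for a
  proof -
    have "a * x = 0" for x
      using that by (simp add: action_kernel_def action_single monomial_action_identity)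
    moreover obtain e where "a * e = a"
      using local_unitE[of a 0] by (auto simp: domain_identity)
    ultimately show ?thesis
      by metis
  qed
  moreover have "0 \<in> base_ring R"
    unfolding base_ring_eq by (metis rangeI single_zero)
  moreover have "0 \<in> action_kernel"
    by (simp add: action_kernel_def zero_in_skew_ring action_zero_left)
  ultimately show ?thesis
    by (fastforce simp: base_ring_eq)
qed

text \<open>
  If \<open>f\<close> centralizes the base ring and has coefficient \<open>a\<close> at \<open>t\<close>, then \<open>a \<delta>\<^sub>t\<close> and
  \<open>a \<delta>\<^sub>0\<close> act in the same way. A faithful action leaves no room for this when \<open>t\<close> is not the
  identity, unless \<open>a\<close> is zero.
\<close>

lemma centralizer_in_base_ring_if_faithful:
  assumes comm: "\<And>x y :: 'a. x * y = y * x" and "action_kernel = {0}"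
  shows "centralizer_in (skew_mult \<alpha>) (skew_ring R) (base_ring R) \<subseteq> base_ring R"
proof
  fix f assume f: "f \<in> centralizer_in (skew_mult \<alpha>) (skew_ring R) (base_ring R)"
  have "Poly_Mapping.lookup f t = 0" if "t \<noteq> 0" for t
  proof -
    define a where "a = Poly_Mapping.lookup f t"
    define d where "d = Poly_Mapping.single 0 a - Poly_Mapping.single t a"
    have "a \<in> R t"
      using f by (simp add: a_def centralizer_in_def skew_ring_def)
    then have singles: "Poly_Mapping.single t a \<in> skew_ring R"
        "Poly_Mapping.single 0 a \<in> skew_ring R"
      by (simp_all add: single_in_skew_ring domain_identity)
    have "monomial_action t a x = a * x" for x
    proof -
      have "skew_mult \<alpha> f (Poly_Mapping.single 0 x) = skew_mult \<alpha> (Poly_Mapping.single 0 x) f"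
        using f by (auto simp: centralizer_in_def base_ring_eq)
      from arg_cong[OF this, of "\<lambda>h. Poly_Mapping.lookup h t"] have "monomial_action t a x = x * a"
        by (simp add: lookup_skew_mult_single_right lookup_skew_mult_single_zero_left
            monomial_action_def a_def)
      then show ?thesis
        using comm by simp
    qed
    then have "d \<in> action_kernel"
      using singles
      by (simp add: d_def action_kernel_def diff_in_skew_ring action_diff action_single
          monomial_action_identity)
    then have "d = 0"
      using assms(2) by simp
    then have "Poly_Mapping.lookup d t = 0"
      by simp
    then show ?thesis
      using that by (simp add: d_def lookup_minus lookup_single a_def)
  qed
  then have "f = Poly_Mapping.single 0 (Poly_Mapping.lookup f 0)"
    by (intro poly_mapping_eqI) (auto simp: lookup_single when_def)
  then show "f \<in> base_ring R"
    by (auto simp: base_ring_eq)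
qed

lemma base_ring_subset_centralizer:
  assumes comm: "\<And>x y :: 'a. x * y = y * x"
  shows "base_ring R \<subseteq> centralizer_in (skew_mult \<alpha>) (skew_ring R) (base_ring R)"
  using base_ring_subset comm
  by (auto simp: centralizer_in_def base_ring_eq skew_mult_single map_identity)

end

section \<open>Maximal commutativity and the ideal intersection property\<close>

theorem theorem2p1:
  fixes R :: "'g::group_add \<Rightarrow> 'a::comm_ring set"
    and \<alpha> :: "'g \<Rightarrow> 'a \<Rightarrow> 'a"
  assumes "partial_action R \<alpha>"
    and "\<And>t. has_local_units (R t)"
  shows "maximal_commutative_in (skew_mult \<alpha>) (skew_ring R) (base_ring R) \<longleftrightarrow>
    (\<forall>I. two_sided_ideal (skew_mult \<alpha>) (skew_ring R) I \<and> I \<noteq> {0} \<longrightarrow> I \<inter> base_ring R \<noteq> {0})"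
    (is "?maximal \<longleftrightarrow> ?intersection")
proof -
  interpret partial_action_with_local_units R \<alpha>
    using assms by (simp add: partial_action_with_local_units_def
        partial_action_with_local_units_axioms_def)
  have comm: "\<And>x y :: 'a. x * y = y * x"
    by (rule mult.commute)
  show ?thesis
  proof
    assume ?maximal
    then have "centralizer_in (skew_mult \<alpha>) (skew_ring R) (base_ring R) = base_ring R"
      by (simp add: maximal_commutative_in_def)
    then show ?intersection
      using ideal_meets_centralizer[OF comm] by (metis IntI singletonD)
  next
    assume ?intersection
    then have "action_kernel = {0}"
      using action_kernel_ideal action_kernel_Int_base_ring by blast
    then have "centralizer_in (skew_mult \<alpha>) (skew_ring R) (base_ring R) = base_ring R"
      using centralizer_in_base_ring_if_faithful[OF comm] base_ring_subset_centralizer[OF comm]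
      by blast
    then show ?maximal
      using base_ring_subset by (auto simp: maximal_commutative_in_def base_ring_eq)
  qed
qed

end
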